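(* Let $q$ be a power of a prime $p$, let $A\in \mathbb{F}_{q}[X]$ be an additive polynomial and, for each integer $n\ge 1$, let $\pi_A(n)$ be the number of elements in $\mathbb{F}_{q^n}$ that are periodic under the map $z\mapsto A(z)$. Then the limit $$\lim_{n\to \infty}\frac{\pi_A(n)}{q^n}$$ does not exist unless $A(X)=aX^{p^h}$ for some $a\in \mathbb{F}_q$ and some integer $h\ge 0$. In the latter case, the limit exists; it equals $0$ if $a=0$ and equals $1$ if $a\ne 0$.
   Context: $\mathbb{F}_q$ denotes the finite field with $q$ elements. A polynomial $f\in\mathbb{F}_q[X]$ is additive if $f(X+Y)=f(X)+f(Y)$ in $\mathbb{F}_q[X,Y]$; equivalently, with $p$ the characteristic, $f=\sum_{i=0}^h a_iX^{p^i}$ with $a_i\in\mathbb{F}_q$ (the zero polynomial is allowed here). An element $y\in\mathbb{F}_{q^n}$ is periodic under $z\mapsto A(z)$ if $A^{(m)}(y)=y$ for some $m\ge 1$, where $A^{(m)}$ is the $m$-fold composition of $A$ with itself. *)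

theory Defs
  imports "HOL-Algebra.Algebraic_Closure_Type" "HOL-Number_Theory.Residues"
begin

text \<open>
  Additivity is the identity \<open>f(X + Y) = f(X) + f(Y)\<close> in \<open>F[X,Y]\<close>, where \<open>F[X,Y]\<close> is
  rendered as \<open>F[X][Y]\<close>: the indeterminates are \<open>x = [:[:0, 1:]:]\<close> and \<open>y = [:0, 1:]\<close>, and
  the coefficients of \<open>f\<close> are embedded as constants \<open>[:[:c:]:]\<close>.
\<close>

definition additive_poly :: "'a::field poly \<Rightarrow> bool" where
  "additive_poly f \<longleftrightarrow>
     (let F = map_poly (\<lambda>c. [:[:c:]:]) f; x = [:[:0, 1:]:]; y = [:0, 1:]
      in poly F (x + y) = poly F x + poly F y)"

text \<open>
  With \<open>'a\<close> the field of \<open>q\<close> elements, the field of \<open>q\<^sup>n\<close> elements is the unique subfield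
  of that cardinality in the algebraic closure of \<open>'a\<close>. The base field is embedded there by
  \<^const>\<open>to_ac\<close>.
\<close>

definition field_ext :: "nat \<Rightarrow> 'a::{field,finite} alg_closure set" where
  "field_ext n =
     (THE K. subfield K (ring_of_type_algebra :: 'a alg_closure ring) \<and>
             card K = card (UNIV :: 'a set) ^ n)"

lemma CHAR_eq_prime:
  assumes "prime p" and "card (UNIV :: 'a::{field,finite} set) = p ^ k"
  shows "CHAR('a) = p"
proof -
  have "CHAR('a) dvd p ^ k" using CHAR_dvd_CARD[where 'a = 'a] assms(2) by simp
  moreover have "prime CHAR('a)"
    using finite_imp_CHAR_pos[where 'a = 'a] prime_CHAR_semidom[where 'a = 'a] by simp
  ultimately show ?thesis
    using assms(1) prime_dvd_power primes_dvd_imp_eq by blast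
qed

lemma card_power_fixpoints:
  assumes "Q > 1" and "of_nat Q = (0 :: 'b::alg_closed_field)"
  shows "card {x :: 'b. x ^ Q = x} = Q"
proof -
  define P :: "'b poly" where "P = Polynomial.monom 1 Q - [:0, 1:]"
  have co: "Polynomial.coeff P i = (if i = Q then 1 else if i = 1 then -1 else 0)" for i
    using assms(1) by (auto simp: P_def coeff_pCons split: nat.splits)
  have deg: "Polynomial.degree P = Q"
    by (rule antisym, rule degree_le) (use assms(1) in \<open>auto simp: co intro!: le_degree\<close>)
  have lc: "Polynomial.lead_coeff P = 1" by (simp add: deg co)
  have nz: "P \<noteq> 0" using lc by force
  obtain M where M: "size M = Q" "P = (\<Prod>x\<in>#M. [:- x, 1:])"
    using alg_closed_imp_factorization[OF nz] lc deg by auto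
  have pd: "pderiv P = [:-1:]"
    using assms(2) by (simp add: P_def pderiv_diff pderiv_monom pderiv_pCons)
  have "count M x \<le> 1" for x
  proof (rule ccontr)
    assume "\<not> count M x \<le> 1"
    then have "count M x \<ge> 2" by simp
    then obtain N where N: "M = N + {#x, x#}"
      by (metis (no_types, lifting) count_le_replicate_mset_subset_eq numeral_2_eq_2 replicate_mset_0
          replicate_mset_Suc subset_mset.less_eqE add.commute)
    have "P = [:-x, 1:] * ([:-x, 1:] * (\<Prod>x\<in>#N. [:- x, 1:]))"
      unfolding M(2) N by (simp add: mult_ac)
    then have "poly (pderiv P) x = 0"
      by (simp only: pderiv_mult) (simp add: pderiv_mult pderiv_pCons)
    then show False by (simp add: pd)
  qed
  then have "size M = card (set_mset M)"
    by (metis size_multiset_overloaded_eq sum.cong card_eq_sum count_greater_eq_one_iff le_antisym)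
  moreover have "set_mset M = {x. x ^ Q = x}"
  proof -
    have "x \<in># M \<longleftrightarrow> poly P x = 0" for x
      by (auto simp: M(2) poly_prod_mset prod_mset_zero_iff)
    then show ?thesis by (auto simp: P_def poly_monom)
  qed
  ultimately show ?thesis using M(1) by simp
qed

lemma subfield_power_card:
  assumes K: "subfield K (ring_of_type_algebra :: 'b::field ring)" and "finite K" and x: "x \<in> K"
  shows "x ^ card K = x"
proof (cases "x = 0")
  case True
  moreover have "card K \<noteq> 0" using assms by auto
  ultimately show ?thesis by (simp add: zero_power)
next
  case False
  let ?R = "ring_of_type_algebra :: 'b ring"
  have cr: "\<And>a b. a \<otimes>\<^bsub>?R\<^esub> b = a * b" "\<one>\<^bsub>?R\<^esub> = 1" "\<zero>\<^bsub>?R\<^esub> = 0"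
    by (simp_all add: ring_of_type_algebra_def)
  interpret R: field ?R by (rule field_from_type_algebra)
  have bij: "bij_betw (\<lambda>y. x * y) (K - {0}) (K - {0})"
  proof -
    have "(\<lambda>y. x * y) ` (K - {0}) \<subseteq> K - {0}"
      using subringE(6)[OF subfieldE(1)[OF K]] x False by (auto simp: cr)
    moreover have "inj_on (\<lambda>y. x * y) (K - {0})" using False by (auto simp: inj_on_def)
    ultimately show ?thesis
      using \<open>finite K\<close> by (metis bij_betw_def endo_inj_surj finite_Diff)
  qed
  have "prod (\<lambda>y. y) (K - {0}) = prod (\<lambda>y. x * y) (K - {0})"
    using prod.reindex_bij_betw[OF bij, of "\<lambda>y. y"] by simp
  also have "\<dots> = x ^ card (K - {0}) * prod (\<lambda>y. y) (K - {0})"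
    by (simp add: prod.distrib)
  finally have "x ^ card (K - {0}) = 1"
    using \<open>finite K\<close> by (simp add: prod_zero_iff)
  moreover have "0 \<in> K" using subringE(2)[OF subfieldE(1)[OF K]] by (simp add: cr)
  then have "card K = Suc (card (K - {0}))"
    using \<open>finite K\<close> by (metis card.remove)
  ultimately show ?thesis by simp
qed

lemma subfield_power_fixpoints:
  assumes "prime CHAR('b::field)" and "Q = CHAR('b) ^ e" and "e > 0"
  shows "subfield {x :: 'b. x ^ Q = x} ring_of_type_algebra"
proof -
  let ?R = "ring_of_type_algebra :: 'b ring"
  interpret R: field ?R by (rule field_from_type_algebra)
  have op: "carrier ?R = UNIV" "\<And>a b. a \<otimes>\<^bsub>?R\<^esub> b = a * b" "\<And>a b. a \<oplus>\<^bsub>?R\<^esub> b = a + b"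
      "\<one>\<^bsub>?R\<^esub> = 1" "\<zero>\<^bsub>?R\<^esub> = 0"
    by (simp_all add: ring_of_type_algebra_def)
  have neg: "\<ominus>\<^bsub>?R\<^esub> a = - a" for a
    using R.minus_equality[of "- a" a] by (simp add: op)
  have inv: "inv\<^bsub>?R\<^esub> a = inverse a" if "a \<noteq> 0" for a
    using R.comm_inv_char[of a "inverse a"] that by (simp add: op)
  have Q0: "Q > 0" using assms by (simp add: prime_gt_0_nat)
  have add: "(a + b) ^ Q = a ^ Q + b ^ Q" for a b :: 'b
    using freshmans_dream' assms by blast
  have "(- a) ^ Q = - (a ^ Q)" for a :: 'b
    using add[of a "- a"] Q0 by (simp add: zero_power eq_neg_iff_add_eq_0 add.commute)
  then have "subring {x :: 'b. x ^ Q = x} ?R"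
    by (intro R.subringI) (auto simp: op neg add power_mult_distrib)
  then show ?thesis
    by (rule R.subfieldI') (auto simp: op inv power_inverse)
qed

text \<open>The subfield in the definition of \<^const>\<open>field_ext\<close> exists and is unique.\<close>

lemma
  fixes K :: "'a::{field,finite} alg_closure set"
  assumes "prime p" and "card (UNIV :: 'a set) = p ^ k" and "n \<ge> 1"
  shows subfield_card_iff:
      "subfield K ring_of_type_algebra \<and> card K = card (UNIV :: 'a set) ^ n \<longleftrightarrow>
       K = {x. x ^ (card (UNIV :: 'a set) ^ n) = x}" (is "?L K \<longleftrightarrow> K = ?F")
    and field_ext_eq:
      "(field_ext n :: 'a alg_closure set) = {x. x ^ (card (UNIV :: 'a set) ^ n) = x}"
    and subfield_field_ext:
      "subfield (field_ext n) (ring_of_type_algebra :: 'a alg_closure ring)"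
    and card_field_ext:
      "card (field_ext n :: 'a alg_closure set) = card (UNIV :: 'a set) ^ n"
proof -
  let ?q = "card (UNIV :: 'a set)"
  have char: "CHAR('a alg_closure) = p" using CHAR_eq_prime[OF assms(1,2)] by simp
  have "card {0, 1 :: 'a} \<le> ?q" by (rule card_mono) auto
  then have q: "?q > 1" by simp
  then have "k > 0" using assms(2) by (cases k) auto
  have Q: "?q ^ n = p ^ (k * n)" "k * n > 0"
    using assms \<open>k > 0\<close> by (simp_all add: power_mult)
  have Q1: "?q ^ n > 1" by (rule one_less_power[OF q]) (use assms(3) in simp)
  have "of_nat (?q ^ n) = (0 :: 'a alg_closure)"
    unfolding of_nat_eq_0_iff_char_dvd char Q(1) using Q(2) by (simp add: dvd_power)
  then have cF: "card ?F = ?q ^ n" by (rule card_power_fixpoints[OF Q1])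
  have sF: "subfield ?F ring_of_type_algebra"
    by (rule subfield_power_fixpoints[where e = "k * n"]) (use Q char assms(1) in auto)
  have fF: "finite ?F" using cF Q1 by (metis card.infinite not_one_less_zero)
  have iff: "?L K \<longleftrightarrow> K = ?F" for K :: "'a alg_closure set"
  proof
    assume L: "?L K"
    then have "finite K" using Q1 by (metis card.infinite not_one_less_zero)
    then have "K \<subseteq> ?F" using subfield_power_card[of K] L by auto
    then show "K = ?F" using card_subset_eq[OF fF] cF L by simp
  qed (use sF cF in auto)
  then show "?L K \<longleftrightarrow> K = ?F" .
  have "(THE K :: 'a alg_closure set. ?L K) = ?F" unfolding iff by simp
  then show eq: "field_ext n = ?F" unfolding field_ext_def .
  show "subfield (field_ext n) (ring_of_type_algebra :: 'a alg_closure ring)"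
    using sF eq by simp
  show "card (field_ext n :: 'a alg_closure set) = ?q ^ n"
    using cF eq by simp
qed

definition periodic_count :: "'a::{field,finite} poly \<Rightarrow> nat \<Rightarrow> nat" where
  "periodic_count A n =
     card {y \<in> field_ext n. \<exists>m\<ge>1. ((\<lambda>z. poly (map_poly to_ac A) z) ^^ m) y = y}"

end

theory Submission
  imports Defs
begin

text \<open>
  Let \<open>\<phi>\<close> be the \<open>q\<close>-Frobenius, which commutes with the additive map \<open>A\<close>. If \<open>A\<close> is not of the
  form \<open>aX^(p^h)\<close>, it has a nonzero root; \<open>\<phi>\<close> permutes the finitely many roots, so all of them
  lie in the field of \<open>q\<^sup>N\<close> elements for some \<open>N\<close>.

  For \<open>n = 1 + pNr\<close> a root in the field of \<open>q\<^sup>n\<close> elements is fixed by \<open>\<phi>\<close>, and as \<open>n\<close> is prime to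
  \<open>p\<close> the image of \<open>\<phi> - 1\<close> on that field contains no nonzero fixed point of \<open>\<phi>\<close>. Hence \<open>A\<close>
  permutes this image, which has \<open>q\<^bsup>n-1\<^esup>\<close> elements, and the ratio is at least \<open>1/q\<close>.

  For \<open>n = N p\<^sup>e\<close> we have \<open>\<phi>\<^sup>n - 1 = (\<phi>\<^sup>N - 1)\<^bsup>p^e\<^esup>\<close>, and filtering the periodic points by
  the kernels of the powers of \<open>\<phi>\<^sup>N - 1\<close> bounds the ratio at \<open>n\<close> by the \<open>p\<^sup>e\<close>-th power of the
  ratio at \<open>N\<close>, which is below 1. So the ratio tends to 0 along these \<open>n\<close>.
\<close>

section \<open>Counting and periodicity on finite sets\<close>

text \<open>Subtracting \<open>s\<close> sends the fibre of \<open>D\<close> over \<open>D s\<close>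
  injectively into the kernel, so no fibre is larger than the kernel.\<close>

lemma card_le_card_image_times_kernel:
  fixes D :: "'b::ab_group_add \<Rightarrow> 'c::ab_group_add"
  assumes "finite S" and diff: "\<And>x y. x \<in> S \<Longrightarrow> y \<in> S \<Longrightarrow> x - y \<in> S"
    and "Modules.additive D"
  shows "card S \<le> card (D ` S) * card {x \<in> S. D x = 0}"
proof -
  have "card S = (\<Sum>t\<in>D ` S. card {x \<in> S. D x = t})"
    using sum.image_gen[OF \<open>finite S\<close>, of "\<lambda>_. 1 :: nat" D] by simp
  also have "\<dots> \<le> (\<Sum>t\<in>D ` S. card {x \<in> S. D x = 0})"
  proof (rule sum_mono)
    fix t assume "t \<in> D ` S"
    then obtain s where s: "s \<in> S" "t = D s" by blast
    show "card {x \<in> S. D x = t} \<le> card {x \<in> S. D x = 0}"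
    proof (rule card_inj_on_le)
      show "inj_on (\<lambda>x. x - s) {x \<in> S. D x = t}" by (auto simp: inj_on_def)
      show "(\<lambda>x. x - s) ` {x \<in> S. D x = t} \<subseteq> {x \<in> S. D x = 0}"
        using s diff by (auto simp: additive.diff[OF assms(3)])
    qed (use \<open>finite S\<close> in simp)
  qed
  finally show ?thesis by simp
qed

text \<open>By the pigeonhole principle two iterates of \<open>y\<close> coincide; injectivity on
  \<open>S\<close> then cancels the earlier one, so there is no preperiod.\<close>

lemma periodic_if_inj_on_finite:
  assumes "finite S" and "f ` S \<subseteq> S" and "inj_on f S" and "y \<in> S"
  shows "\<exists>m\<ge>1. (f ^^ m) y = y"
proof -
  have S: "(f ^^ m) y \<in> S" for m
    by (induction m) (use assms(2,4) in auto)
  have "\<not> inj (\<lambda>m. (f ^^ m) y)"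
  proof
    assume "inj (\<lambda>m. (f ^^ m) y)"
    moreover have "range (\<lambda>m. (f ^^ m) y) \<subseteq> S" using S by auto
    ultimately show False
      using finite_subset[OF _ \<open>finite S\<close>] finite_imageD infinite_UNIV_nat by blast
  qed
  then obtain i j where ij: "i < j" "(f ^^ i) y = (f ^^ j) y"
    unfolding inj_def by (metis linorder_neqE_nat)
  have cancel: "(f ^^ i) u = (f ^^ i) v \<Longrightarrow> u \<in> S \<Longrightarrow> v \<in> S \<Longrightarrow> u = v" for i u v
  proof (induction i arbitrary: u v)
    case (Suc i)
    then have "f u = f v" using assms(2) by (auto simp: funpow_Suc_right simp del: funpow.simps)
    with Suc.prems assms(3) show ?case by (auto dest: inj_onD)
  qed simp
  have "(f ^^ j) y = (f ^^ i) ((f ^^ (j - i)) y)"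
    using ij(1) by (metis add_diff_inverse_nat comp_apply funpow_add less_imp_not_less)
  then have "(f ^^ (j - i)) y = y"
    using cancel[of i y "(f ^^ (j - i)) y"] ij(2) S assms(4) by simp
  then show ?thesis using ij(1) by (intro exI[of _ "j - i"]) auto
qed

section \<open>Iterates of additive maps in characteristic p\<close>

lemma additive_funpow:
  fixes f :: "'b::ab_group_add \<Rightarrow> 'b"
  assumes "Modules.additive f"
  shows "Modules.additive (f ^^ m)"
  by (induction m) (use additive.add[OF assms] in \<open>auto simp: Modules.additive_def\<close>)

lemma funpow_fixpoint: "f x = x \<Longrightarrow> (f ^^ n) x = x"
  by (induction n) simp_all

lemma funpow_commute_funpow:
  assumes "\<And>x. f (g x) = g (f x)"
  shows "(f ^^ m) ((g ^^ n) x) = (g ^^ n) ((f ^^ m) x)"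
proof -
  have "(f ^^ m) (g x) = g ((f ^^ m) x)" for x
    by (induction m) (simp_all add: assms)
  then show ?thesis by (induction n) simp_all
qed

lemma additive_of_nat_mult:
  fixes f :: "'b::comm_ring_1 \<Rightarrow> 'b"
  assumes "Modules.additive f"
  shows "f (of_nat c * x) = of_nat c * f x"
  by (induction c)
    (simp_all add: additive.zero[OF assms] additive.add[OF assms] distrib_right)

text \<open>The binomial theorem for \<open>\<phi> = 1 + (\<phi> - 1)\<close> in the ring of additive maps.\<close>

lemma funpow_binomial:
  fixes \<phi> :: "'b::comm_ring_1 \<Rightarrow> 'b"
  assumes "Modules.additive \<phi>"
  shows "(\<phi> ^^ m) x = (\<Sum>i\<le>m. of_nat (m choose i) * ((\<lambda>x. \<phi> x - x) ^^ i) x)"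
proof (induction m)
  case (Suc m)
  let ?D = "\<lambda>x. \<phi> x - x"
  have \<phi>: "\<phi> ((?D ^^ i) x) = (?D ^^ i) x + (?D ^^ Suc i) x" for i by simp
  have "(\<phi> ^^ Suc m) x = (\<Sum>i\<le>m. of_nat (m choose i) * \<phi> ((?D ^^ i) x))"
    by (simp add: Suc additive.sum[OF assms] additive_of_nat_mult[OF assms])
  also have "\<dots> = (\<Sum>i\<le>m. of_nat (m choose i) * (?D ^^ i) x)
                + (\<Sum>i\<le>m. of_nat (m choose i) * (?D ^^ Suc i) x)"
    by (simp only: \<phi> distrib_left sum.distrib)
  also have "(\<Sum>i\<le>m. of_nat (m choose i) * (?D ^^ i) x)
      = x + (\<Sum>i\<le>m. of_nat (m choose Suc i) * (?D ^^ Suc i) x)"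
  proof -
    have "(\<Sum>i\<le>m. of_nat (m choose i) * (?D ^^ i) x)
        = (\<Sum>i\<le>Suc m. of_nat (m choose i) * (?D ^^ i) x)" by (simp add: binomial_eq_0)
    then show ?thesis by (simp only: sum.atMost_Suc_shift) simp
  qed
  finally show ?case
    by (simp only: sum.atMost_Suc_shift)
      (simp add: sum.distrib distrib_right add.assoc add.commute del: funpow.simps)
qed simp

text \<open>In characteristic \<open>p\<close> the binomial coefficients strictly between the two
  ends vanish, so only the terms \<open>i = 0\<close> and \<open>i = p\<close> survive.\<close>

lemma funpow_minus_id_prime:
  fixes \<phi> :: "'b::comm_ring_1 \<Rightarrow> 'b"
  assumes "Modules.additive \<phi>" and "prime p" and "of_nat p = (0 :: 'b)"
  shows "((\<lambda>x. \<phi> x - x) ^^ p) x = (\<phi> ^^ p) x - x"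
proof -
  let ?t = "\<lambda>i. of_nat (p choose i) * ((\<lambda>x. \<phi> x - x) ^^ i) x"
  have "p > 0" using assms(2) by (simp add: prime_gt_0_nat)
  have "?t i = 0" if "i \<in> {..p} - {0, p}" for i
  proof -
    have "p dvd p choose i"
      using that assms(2) by (intro dvd_choose_prime) auto
    then have "of_nat (p choose i) = (0 :: 'b)" using assms(3) by (auto elim!: dvdE)
    then show ?thesis by simp
  qed
  then have "(\<Sum>i\<le>p. ?t i) = (\<Sum>i\<in>{0, p}. ?t i)"
    by (intro sum.mono_neutral_right) auto
  then show ?thesis using \<open>p > 0\<close> by (simp add: funpow_binomial[OF assms(1)])
qed

text \<open>The induction applies the prime case to the additive map
  \<open>\<phi> ^^ (p ^ e)\<close>.\<close>

lemma funpow_minus_id_prime_power: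
  fixes \<phi> :: "'b::comm_ring_1 \<Rightarrow> 'b"
  assumes "Modules.additive \<phi>" and "prime p" and "of_nat p = (0 :: 'b)"
  shows "((\<lambda>x. \<phi> x - x) ^^ (p ^ e)) x = (\<phi> ^^ (p ^ e)) x - x"
proof (induction e arbitrary: x)
  case (Suc e)
  have "((\<lambda>x. \<phi> x - x) ^^ (p ^ e)) = (\<lambda>x. (\<phi> ^^ (p ^ e)) x - x)"
    using Suc by auto
  then have "((\<lambda>x. \<phi> x - x) ^^ (p ^ Suc e)) x = ((\<lambda>x. (\<phi> ^^ (p ^ e)) x - x) ^^ p) x"
    by (metis funpow_mult power_Suc2)
  also have "\<dots> = (\<phi> ^^ (p ^ Suc e)) x - x"
    by (subst funpow_minus_id_prime[OF additive_funpow[OF assms(1)] assms(2,3)])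
      (simp add: funpow_mult mult.commute)
  finally show ?case .
qed simp

section \<open>Frobenius powers and periodic points\<close>

lemma funpow_power:
  fixes x :: "'b::monoid_mult"
  shows "((\<lambda>x. x ^ Q) ^^ m) x = x ^ (Q ^ m)"
  by (induction m) (simp_all add: power_mult[symmetric] mult.commute)

lemma additive_Frobenius:
  assumes "prime CHAR('b::comm_ring_1)" and "Q = CHAR('b) ^ e"
  shows "Modules.additive (\<lambda>x :: 'b. x ^ Q)"
  unfolding Modules.additive_def using freshmans_dream' assms by blast

lemma additive_minus_id:
  "Modules.additive \<phi> \<Longrightarrow> Modules.additive (\<lambda>x. \<phi> x - x)"
  by (simp add: Modules.additive_def algebra_simps)

lemma commute_power_power:
  fixes f :: "'b::monoid_mult \<Rightarrow> 'b"
  assumes "\<And>x. f (x ^ q) = f x ^ q"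
  shows "f (x ^ (q ^ n)) = f x ^ (q ^ n)"
  using funpow_commute_funpow[of f "\<lambda>x. x ^ q" 1 n x] assms by (simp add: funpow_power)

text \<open>The product of the two periods is a common period. Closure under differences is what the
  fibre count asks for.\<close>

lemma periodic_diff:
  assumes "Modules.additive f"
    and "\<exists>m\<ge>1. (f ^^ m) x = x" and "\<exists>m\<ge>1. (f ^^ m) y = y"
  shows "\<exists>m\<ge>1. (f ^^ m) (x - y) = x - y"
proof -
  from assms obtain m n where mn: "m \<ge> 1" "(f ^^ m) x = x" "n \<ge> 1" "(f ^^ n) y = y" by blast
  have "(f ^^ (m * n)) x = x" "(f ^^ (m * n)) y = y"
    using funpow_fixpoint[of "f ^^ m" x n] funpow_fixpoint[of "f ^^ n" y m] mn
    by (simp_all add: funpow_mult mult.commute)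
  then have "(f ^^ (m * n)) (x - y) = x - y"
    by (simp add: additive.diff[OF additive_funpow[OF assms(1)]])
  then show ?thesis using mn by (intro exI[of _ "m * n"]) auto
qed

lemma periodic_commute:
  assumes "\<And>x. f (g x) = g (f x)" and "\<exists>m\<ge>1. (f ^^ m) x = x"
  shows "\<exists>m\<ge>1. (f ^^ m) (g x) = g x"
  using funpow_commute_funpow[of f g _ 1 x, OF assms(1)] assms(2) by auto

section \<open>Lower and upper bounds for the number of periodic points\<close>

text \<open>
  If \<open>w = z\<^sup>q - z\<close> is fixed by the \<open>q\<close>-Frobenius, then \<open>z\<^bsup>q^n\<^esup> = z + n w\<close>; this is why \<open>f\<close> is
  injective on the image of \<open>x \<mapsto> x\<^sup>q - x\<close>.
\<close>

lemma periodic_count_lower: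
  fixes f :: "'b::field \<Rightarrow> 'b"
  assumes char: "prime CHAR('b)" "q = CHAR('b) ^ k"
    and add: "Modules.additive f" and frob: "\<And>x. f (x ^ q) = f x ^ q"
    and roots: "\<And>x. f x = 0 \<Longrightarrow> x ^ (q ^ N) = x"
    and n: "n = 1 + N * (CHAR('b) * r)"
    and fin: "finite {x :: 'b. x ^ (q ^ n) = x}"
  shows "card {x :: 'b. x ^ (q ^ n) = x} \<le>
    card {x \<in> {x :: 'b. x ^ (q ^ n) = x}. \<exists>m\<ge>1. (f ^^ m) x = x} * card {x :: 'b. x ^ q = x}"
proof -
  define V where "V = {x :: 'b. x ^ (q ^ n) = x}"
  define D where "D = (\<lambda>x :: 'b. x ^ q - x)"
  have F: "Modules.additive (\<lambda>x :: 'b. x ^ q)" by (rule additive_Frobenius[OF char])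
  have Fn: "Modules.additive (\<lambda>x :: 'b. x ^ (q ^ n))"
    by (rule additive_Frobenius[OF char(1), of _ "k * n"]) (simp add: char(2) power_mult)
  have D: "Modules.additive D" unfolding D_def by (rule additive_minus_id[OF F])
  have Vdiff: "x - y \<in> V" if "x \<in> V" "y \<in> V" for x y
    using that by (simp add: V_def additive.diff[OF Fn])
  have VF: "x ^ q \<in> V" if "x \<in> V" for x
    using that commute_power_power[of "\<lambda>x. x ^ q" q x n] by (simp add: V_def)
  have Vf: "f x \<in> V" if "x \<in> V" for x
    using that commute_power_power[of f q x n, OF frob] by (simp add: V_def)
  have fD: "f (D x) = D (f x)" for x by (simp add: D_def additive.diff[OF add] frob)
  have fV: "f ` (D ` V) \<subseteq> D ` V" using fD Vf by auto
  have DV: "D ` V \<subseteq> V" using Vdiff VF by (auto simp: D_def)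
  have ker: "w = 0" if w: "w \<in> D ` V" "f w = 0" for w
  proof -
    obtain z where z: "z \<in> V" "w = D z" using w(1) by blast
    \<comment> \<open>As \<open>n\<close> is 1 modulo \<open>N\<close> and the root \<open>w\<close>
      is fixed by the power \<open>q ^ N\<close>, the power \<open>q ^ n\<close> acts on
      \<open>w\<close> as the \<open>q\<close>-Frobenius; \<open>w \<in> V\<close> then gives
      \<open>w ^ q = w\<close>.\<close>
    have "w ^ (q ^ n) = (w ^ (q ^ (N * (CHAR('b) * r)))) ^ q"
      by (simp add: n power_mult[symmetric] mult.commute)
    also have "w ^ (q ^ (N * (CHAR('b) * r))) = w"
      using funpow_fixpoint[of "\<lambda>x. x ^ (q ^ N)" w "CHAR('b) * r"] roots[OF w(2)]
      by (simp add: funpow_power power_mult)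
    finally have wq: "w ^ q = w" using w(1) DV by (auto simp: V_def)
    have zq: "z ^ q = z + w" by (simp add: z(2) D_def)
    have "z ^ (q ^ i) = z + of_nat i * w" for i
    proof (induction i)
      case (Suc i)
      have "z ^ (q ^ Suc i) = (z ^ (q ^ i)) ^ q" by (simp add: power_mult[symmetric] mult.commute)
      also have "\<dots> = z ^ q + of_nat i * w ^ q"
        unfolding Suc by (simp add: additive.add[OF F] additive_of_nat_mult[OF F])
      finally show ?case by (simp add: zq wq algebra_simps)
    qed simp
    \<comment> \<open>At \<open>i = n\<close> the left side is \<open>z\<close>, and
      \<open>n\<close> is 1 modulo the characteristic, so \<open>z = z + w\<close>.\<close>
    from this[of n] show "w = 0" using z(1) by (simp add: V_def n)
  qed
  have inj: "inj_on f (D ` V)"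
  proof (rule inj_onI)
    fix x y assume xy: "x \<in> D ` V" "y \<in> D ` V" "f x = f y"
    then obtain u v where "x = D u" "y = D v" "u \<in> V" "v \<in> V" by blast
    then have "x - y \<in> D ` V" using Vdiff by (metis additive.diff[OF D] imageI)
    then show "x = y" using ker[of "x - y"] xy(3) by (simp add: additive.diff[OF add])
  qed
  have finV: "finite V" using fin by (simp add: V_def)
  have "D ` V \<subseteq> {x \<in> V. \<exists>m\<ge>1. (f ^^ m) x = x}"
    using periodic_if_inj_on_finite[OF finite_imageI[OF finV] fV inj] DV by blast
  then have 1: "card (D ` V) \<le> card {x \<in> V. \<exists>m\<ge>1. (f ^^ m) x = x}"
    using finV by (intro card_mono) auto
  have "{x \<in> V. D x = 0} = {x. x ^ q = x}"
  proof -
    have "x ^ (q ^ n) = x" if "x ^ q = x" for x :: 'b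
      using funpow_fixpoint[of "\<lambda>x. x ^ q" x n] that by (simp add: funpow_power)
    then show ?thesis by (auto simp: V_def D_def)
  qed
  then have "card V \<le> card (D ` V) * card {x :: 'b. x ^ q = x}"
    using card_le_card_image_times_kernel[OF finV Vdiff D] by simp
  also have "\<dots> \<le> card {x \<in> V. \<exists>m\<ge>1. (f ^^ m) x = x} * card {x :: 'b. x ^ q = x}"
    using 1 by simp
  finally show ?thesis by (simp add: V_def)
qed

text \<open>Let \<open>U i\<close> be the periodic points killed by \<open>D ^^ i\<close>, where
  \<open>D\<close> is \<open>\<phi> - 1\<close>. Then \<open>D\<close> maps \<open>U (Suc i)\<close>
  into \<open>U i\<close> with kernel \<open>U 1\<close>, so each level multiplies the size by at
  most \<open>card (U 1)\<close>. In characteristic p, level \<open>p ^ e\<close> is the set on the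
  left.\<close>

lemma periodic_count_upper:
  fixes f :: "'b::field \<Rightarrow> 'b"
  assumes char: "prime CHAR('b)" "q = CHAR('b) ^ k"
    and add: "Modules.additive f" and frob: "\<And>x. f (x ^ q) = f x ^ q"
    and fin: "finite {x :: 'b. x ^ (q ^ N) = x}"
  shows "card {x \<in> {x :: 'b. x ^ (q ^ (N * CHAR('b) ^ e)) = x}. \<exists>m\<ge>1. (f ^^ m) x = x}
    \<le> card {x \<in> {x :: 'b. x ^ (q ^ N) = x}. \<exists>m\<ge>1. (f ^^ m) x = x} ^ (CHAR('b) ^ e)"
proof -
  define \<phi> where "\<phi> = (\<lambda>x :: 'b. x ^ (q ^ N))"
  define D where "D = (\<lambda>x. \<phi> x - x)"
  define P where "P = {x. \<exists>m\<ge>1. (f ^^ m) x = x}"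
  define U where "U = (\<lambda>i. {x \<in> P. (D ^^ i) x = 0})"
  have \<phi>: "Modules.additive \<phi>" unfolding \<phi>_def
    by (rule additive_Frobenius[OF char(1), of _ "k * N"]) (simp add: char(2) power_mult)
  have D: "Modules.additive D" unfolding D_def by (rule additive_minus_id[OF \<phi>])
  have Pdiff: "x - y \<in> P" if "x \<in> P" "y \<in> P" for x y
    using periodic_diff[OF add] that by (simp add: P_def)
  have fD: "f (D x) = D (f x)" for x
    by (simp add: D_def \<phi>_def additive.diff[OF add] commute_power_power[of f q, OF frob])
  have PD: "D x \<in> P" if "x \<in> P" for x
    using periodic_commute[of f D, OF fD] that by (simp add: P_def)
  have Udiff: "x - y \<in> U i" if "x \<in> U i" "y \<in> U i" for x y i
    using that Pdiff by (simp add: U_def additive.diff[OF additive_funpow[OF D]])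
  have zeroP: "0 \<in> P"
    by (auto simp: P_def additive.zero[OF additive_funpow[OF add]] intro!: exI[of _ 1])
  have U1: "U 1 = {x \<in> {x :: 'b. x ^ (q ^ N) = x}. \<exists>m\<ge>1. (f ^^ m) x = x}"
    by (auto simp: U_def P_def D_def \<phi>_def)
  have finU1: "finite (U 1)" unfolding U1 using fin by simp
  have DU: "D ` U (Suc i) \<subseteq> U i" for i
    using PD by (auto simp: U_def funpow_Suc_right simp del: funpow.simps)
  have kerU: "{x \<in> U (Suc i). D x = 0} = U 1" for i
    by (auto simp: U_def funpow_Suc_right additive.zero[OF additive_funpow[OF D]]
        simp del: funpow.simps)
  have "finite (U i) \<and> card (U i) \<le> card (U 1) ^ i" for i
  proof (induction i)
    case 0
    have "U 0 = {0}" using zeroP by (auto simp: U_def)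
    then show ?case by simp
  next
    case (Suc i)
    \<comment> \<open>The fibre count needs finiteness, so the induction carries it along:
      \<open>D\<close> maps into the finite \<open>U i\<close>, and each fibre is empty or lies in a
      translate of \<open>U 1\<close>.\<close>
    have fin': "finite (U (Suc i))"
    proof (rule finite_finite_vimage_IntI[of _ D "U (Suc i)", THEN finite_subset[rotated]])
      show "finite (U i)" using Suc by simp
      show "U (Suc i) \<subseteq> D -` U i \<inter> U (Suc i)" using DU by blast
      fix t assume "t \<in> U i"
      show "finite (D -` {t} \<inter> U (Suc i))"
      proof (cases "\<exists>s \<in> U (Suc i). D s = t")
        case True
        then obtain s where s: "s \<in> U (Suc i)" "D s = t" by blast
        have "D -` {t} \<inter> U (Suc i) \<subseteq> (\<lambda>x. x + s) ` U 1"
        proof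
          fix x assume x: "x \<in> D -` {t} \<inter> U (Suc i)"
          then have "x - s \<in> {x \<in> U (Suc i). D x = 0}"
            using s Udiff by (simp add: additive.diff[OF D])
          then show "x \<in> (\<lambda>x. x + s) ` U 1"
            unfolding kerU by (intro image_eqI[of _ _ "x - s"]) auto
        qed
        then show ?thesis using finU1 finite_subset by blast
      next
        case False
        then have "D -` {t} \<inter> U (Suc i) = {}" by blast
        then show ?thesis by simp
      qed
    qed
    have "card (U (Suc i)) \<le> card (D ` U (Suc i)) * card (U 1)"
      using card_le_card_image_times_kernel[OF fin' Udiff D] by (simp add: kerU)
    also have "\<dots> \<le> card (U i) * card (U 1)"
      using card_mono[OF _ DU] Suc by simp
    also have "\<dots> \<le> card (U 1) ^ i * card (U 1)" using Suc by simp
    finally show ?case using fin' by (simp add: mult.commute)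
  qed
  moreover have "U (CHAR('b) ^ e) =
      {x \<in> {x :: 'b. x ^ (q ^ (N * CHAR('b) ^ e)) = x}. \<exists>m\<ge>1. (f ^^ m) x = x}"
  proof -
    have "(D ^^ (CHAR('b) ^ e)) x = x ^ (q ^ (N * CHAR('b) ^ e)) - x" for x
      unfolding D_def
      by (subst funpow_minus_id_prime_power[OF \<phi> char(1)])
        (simp_all add: \<phi>_def funpow_power power_mult)
    then show ?thesis by (auto simp: U_def P_def)
  qed
  ultimately show ?thesis using U1 by metis
qed


section \<open>From formal additivity to an additive map\<close>

text \<open>Here \<open>h\<close> is first \<open>to_ac\<close>, which evaluates the inner variable,
  and then that evaluation itself, which evaluates the outer one.\<close>

lemma
  fixes h :: "'r::comm_ring_1 \<Rightarrow> 's::comm_ring_1"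
  assumes "Modules.additive h" and "\<And>x y. h (x * y) = h x * h y"
  shows poly_map_poly_add: "poly (map_poly h (P + Q)) u = poly (map_poly h P) u + poly (map_poly h Q) u"
    and poly_map_poly_mult: "poly (map_poly h (P * Q)) u = poly (map_poly h P) u * poly (map_poly h Q) u"
proof -
  have h0: "h 0 = 0" by (rule additive.zero[OF assms(1)])
  have pc: "poly (map_poly h (pCons a R)) u = h a + u * poly (map_poly h R) u" for a R
    by (simp add: map_poly_pCons[of h, OF h0])
  have add: "poly (map_poly h (P + Q)) u = poly (map_poly h P) u + poly (map_poly h Q) u" for P Q
    by (induction P Q rule: poly_induct2)
      (simp_all add: pc additive.add[OF assms(1)] algebra_simps)
  show "poly (map_poly h (P + Q)) u = poly (map_poly h P) u + poly (map_poly h Q) u" by (rule add)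
  have smult: "poly (map_poly h (smult a R)) u = h a * poly (map_poly h R) u" for a R
    by (induction R) (simp_all add: pc assms(2) h0 algebra_simps)
  show "poly (map_poly h (P * Q)) u = poly (map_poly h P) u * poly (map_poly h Q) u"
    by (induction P) (simp_all add: pc add smult h0 algebra_simps)
qed

lemma additive_to_ac: "Modules.additive to_ac"
  by (simp add: Modules.additive_def)

text \<open>The formal identity in \<open>F[X][Y]\<close> is carried to the closure by the
  homomorphism \<open>E\<close> sending X to \<open>u\<close> and Y to \<open>v\<close>.\<close>

lemma additive_poly_imp_additive_map:
  fixes A :: "'a::field poly"
  assumes "additive_poly A"
  shows "Modules.additive (poly (map_poly to_ac A))"
proof -
  have "poly (map_poly to_ac A) (u + v) = poly (map_poly to_ac A) u + poly (map_poly to_ac A) v"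
    for u v :: "'a alg_closure"
  proof -
    define e where "e = (\<lambda>g :: 'a poly. poly (map_poly to_ac g) u)"
    define E where "E = (\<lambda>G. poly (map_poly e G) v)"
    define F where "F = map_poly (\<lambda>c :: 'a. [:[:c:]:]) A"
    have e: "Modules.additive e" "\<And>x y. e (x * y) = e x * e y"
      unfolding Modules.additive_def e_def
      by (simp_all add: poly_map_poly_add[OF additive_to_ac] poly_map_poly_mult[OF additive_to_ac])
    have E: "E (P + Q) = E P + E Q" "E (P * Q) = E P * E Q" for P Q
      unfolding E_def by (rule poly_map_poly_add[OF e] poly_map_poly_mult[OF e])+
    have e0: "e 0 = 0" by (simp add: e_def)
    have const: "E [:[:c:]:] = to_ac c" for c
      by (simp add: E_def e_def map_poly_pCons)
    \<comment> \<open>\<open>E\<close> turns the constant \<open>[:[:c:]:]\<close> into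
      \<open>to_ac c\<close>, so it passes through the substitution of \<open>Z\<close>.\<close>
    have ev: "E (poly (map_poly (\<lambda>c :: 'a. [:[:c:]:]) R) Z) = poly (map_poly to_ac R) (E Z)" for Z R
    proof (induction R)
      case 0
      then show ?case by (simp add: E_def)
    next
      case (pCons a R)
      then show ?case by (simp add: map_poly_pCons E const)
    qed
    have X: "E [:[:0, 1:]:] = u" "E [:0, 1:] = v"
      by (simp_all add: E_def e_def map_poly_pCons)
    have "poly F ([:[:0, 1:]:] + [:0, 1:]) = poly F [:[:0, 1:]:] + poly F [:0, 1:]"
      using assms unfolding additive_poly_def Let_def F_def .
    then have "E (poly F ([:[:0, 1:]:] + [:0, 1:])) = E (poly F [:[:0, 1:]:] + poly F [:0, 1:])"
      by simp
    then show ?thesis by (simp only: F_def ev E X)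
  qed
  then show ?thesis by (simp add: Modules.additive_def)
qed

section \<open>Additive polynomials whose only root is zero\<close>

text \<open>Over a finite field, 1 plus the product of all \<open>X - a\<close> is nonconstant and
  has no root.\<close>

lemma infinite_alg_closed: "infinite (UNIV :: 'b::alg_closed_field set)"
proof
  assume fin: "finite (UNIV :: 'b set)"
  define P :: "'b poly" where "P = (\<Prod>a\<in>UNIV. [:- a, 1:])"
  have "Polynomial.degree P = (\<Sum>a\<in>(UNIV :: 'b set). 1)"
    unfolding P_def by (subst degree_prod_eq_sum_degree) auto
  then have deg: "Polynomial.degree P > 0" using fin by (simp add: card_gt_0_iff)
  then have "Polynomial.degree (P + 1) > 0" by (subst degree_add_eq_left) auto
  then obtain x where "poly (P + 1) x = 0" using alg_closed_imp_poly_has_root by blast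
  moreover have "poly P x = 0" using fin by (auto simp: P_def poly_prod)
  ultimately show False by simp
qed

text \<open>With \<open>d = p ^ h * m\<close> and \<open>m\<close> prime to \<open>p\<close>,
  undoing the Frobenius reduces the identity to exponent \<open>m\<close>; derivatives at 0 then
  force \<open>m = 1\<close>.\<close>

lemma power_eq_power_plus_one_imp_prime_power:
  assumes char: "prime CHAR('b::alg_closed_field)" and "d > 0"
    and eq: "\<And>x :: 'b. (x + 1) ^ d = x ^ d + 1"
  shows "\<exists>h. d = CHAR('b) ^ h"
proof -
  define p where "p = CHAR('b)"
  define h where "h = multiplicity p d"
  obtain m where m: "d = p ^ h * m" "\<not> p dvd m"
    using multiplicity_decompose'[of d p] \<open>d > 0\<close> char unfolding h_def p_def
    by (metis not_prime_unit not_gr_zero)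
  have F: "Modules.additive (\<lambda>x :: 'b. x ^ (p ^ h))"
    by (rule additive_Frobenius[OF char]) (simp add: p_def)
  have eq': "(x + 1) ^ m = x ^ m + 1" for x :: 'b
  proof -
    \<comment> \<open>By additivity of the power \<open>p ^ h\<close>, the left side is
      \<open>(x + 1) ^ d - (x ^ d + 1)\<close>; a field has no nonzero nilpotents.\<close>
    have "((x + 1) ^ m - (x ^ m + 1)) ^ (p ^ h) = 0"
      using eq[of x] by (simp only: additive.diff[OF F] additive.add[OF F])
        (simp add: m(1) power_mult[symmetric] mult.commute)
    then show ?thesis by simp
  qed
  \<comment> \<open>An identity at all points of an infinite field holds between polynomials, so it
    can be differentiated.\<close>
  have "[:1, 1:] ^ m - (Polynomial.monom 1 m + 1) = (0 :: 'b poly)" (is "?P = 0")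
  proof (rule ccontr)
    assume "?P \<noteq> 0"
    then have "finite {x. poly ?P x = 0}" by (rule poly_roots_finite)
    moreover have "poly ?P x = 0" for x
      using eq'[of x] by (simp add: poly_monom add.commute)
    ultimately show False using infinite_alg_closed[where 'b = 'b] by simp
  qed
  then have "poly (pderiv ?P) 0 = 0" by (simp only: pderiv_0 poly_0)
  moreover obtain m' where m': "m = Suc m'" using m(2) by (cases m) auto
  moreover have "poly (pderiv ([:1, 1:] ^ m)) 0 = (of_nat m :: 'b)"
    unfolding m' by (subst pderiv_power_Suc) (simp add: pderiv_pCons)
  moreover have "poly (pderiv (Polynomial.monom 1 m + 1)) 0 = (of_nat m * 0 ^ m' :: 'b)"
    by (simp add: m' pderiv_add pderiv_monom poly_monom)
  ultimately have "of_nat m = (of_nat m * 0 ^ m' :: 'b)"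
    by (simp only: pderiv_diff poly_diff right_minus_eq)
  \<comment> \<open>Cancelling \<open>of_nat m\<close> leaves \<open>0 ^ m' = 1\<close>, which holds
    only for \<open>m' = 0\<close>.\<close>
  moreover have "of_nat m \<noteq> (0 :: 'b)"
    using m(2) by (simp add: of_nat_eq_0_iff_char_dvd p_def)
  ultimately have "m' = 0" by (cases m') (simp_all only: power_Suc mult_zero_left
      mult_zero_right simp_thms)
  then show ?thesis using m(1) m' by (auto simp: p_def)
qed

text \<open>If 0 is the only root, factoring over the closure leaves one term
  \<open>c * X ^ d\<close>, and additivity at \<open>x\<close> and 1 makes \<open>d\<close> a power
  of the characteristic.\<close>

lemma additive_poly_nonzero_root:
  fixes A :: "'a::field poly"
  assumes char: "prime CHAR('a)" and "additive_poly A"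
    and nmon: "\<not> (\<exists>a h. A = Polynomial.monom a (CHAR('a) ^ h))"
  shows "\<exists>y. y \<noteq> 0 \<and> poly (map_poly to_ac A) y = 0"
proof (rule ccontr)
  assume no: "\<not> ?thesis"
  define B where "B = map_poly to_ac A"
  define d where "d = Polynomial.degree B"
  have "A \<noteq> 0" using nmon by (metis monom_eq_0)
  then have "B \<noteq> 0" by (simp add: B_def map_poly_eq_0_iff)
  then obtain M where M: "size M = d"
      "B = smult (Polynomial.lead_coeff B) (\<Prod>x\<in>#M. [:- x, 1:])"
    using alg_closed_imp_factorization unfolding d_def by metis
  have "x = 0" if "x \<in># M" for x
  proof -
    have "poly B x = 0" using that by (subst M(2)) (auto simp: poly_prod_mset prod_mset_zero_iff)
    then show ?thesis using no by (auto simp: B_def)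
  qed
  then have "M = replicate_mset d 0"
    using M(1) by (metis set_mset_subset_singletonD subsetI singletonI)
  then have "(\<Prod>x\<in>#M. [:- x, 1:]) = [:0, 1:] ^ d" by simp
  then have B: "B = Polynomial.monom (Polynomial.lead_coeff B) d"
    using M(2) by (simp add: monom_altdef)
  have A: "A = Polynomial.monom (Polynomial.coeff A d) d"
  proof (rule poly_eqI)
    fix i
    have "to_ac (Polynomial.coeff A i) = Polynomial.coeff B i" for i
      by (simp add: B_def coeff_map_poly)
    then show "Polynomial.coeff A i = Polynomial.coeff (Polynomial.monom (Polynomial.coeff A d) d) i"
      by (metis B coeff_monom to_ac_eq_0_iff)
  qed
  define c where "c = Polynomial.coeff A d"
  have c: "c \<noteq> 0" using A \<open>A \<noteq> 0\<close> by (metis c_def monom_eq_0)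
  have ev: "poly B x = to_ac c * x ^ d" for x
    unfolding B_def by (subst A) (simp add: map_poly_monom poly_monom c_def)
  have addB: "Modules.additive (poly B)"
    unfolding B_def by (rule additive_poly_imp_additive_map[OF assms(2)])
  \<comment> \<open>This excludes a nonzero constant: an additive map vanishes at 0.\<close>
  have "d > 0" using additive.zero[OF addB] c by (cases d) (auto simp: ev)
  have "(x + 1) ^ d = x ^ d + 1" for x :: "'a alg_closure"
  proof -
    have "to_ac c * (x + 1) ^ d = to_ac c * (x ^ d + 1)"
      using additive.add[OF addB, of x 1] by (simp add: ev algebra_simps)
    then show ?thesis using c by simp
  qed
  then have "\<exists>h. d = CHAR('a alg_closure) ^ h"
    using power_eq_power_plus_one_imp_prime_power[of d, where 'b = "'a alg_closure"]
      char \<open>d > 0\<close> by simp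
  then show False using nmon A by auto
qed

section \<open>Frobenius on the roots and on the coefficients\<close>

text \<open>Periods are multiplied. For the Frobenius on the roots of \<open>A\<close> this puts all
  roots in one finite field.\<close>

lemma finite_common_period:
  assumes "finite S" and "\<And>y. y \<in> S \<Longrightarrow> \<exists>m\<ge>1. (g ^^ m) y = y"
  shows "\<exists>N\<ge>1. \<forall>y\<in>S. (g ^^ N) y = y"
  using assms
proof (induction S)
  case (insert x S)
  then obtain N m where N: "N \<ge> 1" "\<forall>y\<in>S. (g ^^ N) y = y" and m: "m \<ge> 1" "(g ^^ m) x = x"
    by (metis insertCI)
  have "(g ^^ (N * m)) y = y" if "y \<in> insert x S" for y
    using that N(2) funpow_fixpoint[of "g ^^ N" y m] funpow_fixpoint[of "g ^^ m" y N] m(2)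
    by (auto simp: funpow_mult mult.commute)
  then show ?case using N(1) m(1) by (intro exI[of _ "N * m"]) auto
qed auto

text \<open>The power \<open>p ^ k\<close> is additive and multiplicative, and it fixes the
  coefficients because they lie in a field of \<open>p ^ k\<close> elements.\<close>

lemma poly_to_ac_power_card:
  fixes A :: "'a::{field,finite} poly"
  assumes "prime p" and "card (UNIV :: 'a set) = p ^ k"
  shows "poly (map_poly to_ac A) (x ^ (p ^ k)) = poly (map_poly to_ac A) x ^ (p ^ k)"
proof -
  have char: "CHAR('a alg_closure) = p" using CHAR_eq_prime[OF assms] by simp
  have F: "Modules.additive (\<lambda>x :: 'a alg_closure. x ^ (p ^ k))"
    by (rule additive_Frobenius) (use char assms in auto)
  have "subfield (UNIV :: 'a set) ring_of_type_algebra"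
  proof -
    interpret R: field "ring_of_type_algebra :: 'a ring" by (rule field_from_type_algebra)
    show ?thesis using R.carrier_is_subfield by (simp add: ring_of_type_algebra_def)
  qed
  then have q: "a ^ (p ^ k) = a" for a :: 'a
    using subfield_power_card[of "UNIV :: 'a set" a] assms(2) by simp
  show ?thesis
  proof (induction A)
    case (pCons a A)
    have "to_ac a ^ (p ^ k) = to_ac a" by (metis q to_ac_power)
    then show ?case
      by (simp add: map_poly_pCons pCons additive.add[OF F] power_mult_distrib)
  next
    case 0
    show ?case using assms(1) by (simp add: prime_gt_0_nat)
  qed
qed

section \<open>Limits along two subsequences, and the monomial case\<close>

theorem theorem1p7:
  fixes A :: "'a::{field,finite} poly" and p k q :: nat
  assumes "prime p" and "k \<ge> 1" and "q = p ^ k"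
    and "card (UNIV :: 'a set) = q"
    and "additive_poly A"
  shows "(\<not> (\<exists>a h. A = Polynomial.monom a (p ^ h)) \<longrightarrow>
            \<not> convergent (\<lambda>n. real (periodic_count A n) / real (q ^ n))) \<and>
         (\<forall>a h. A = Polynomial.monom a (p ^ h) \<longrightarrow>
            (\<lambda>n. real (periodic_count A n) / real (q ^ n)) \<longlonglongrightarrow> (if a = 0 then 0 else 1))"
proof -
  define f where "f = poly (map_poly to_ac A)"
  \<comment> \<open>For \<open>n \<ge> 1\<close> this is the field of \<open>q ^ n\<close> elements,
    but for \<open>n = 0\<close> it is the whole closure; hence the conditions
    \<open>n \<ge> 1\<close> below.\<close>
  let ?V = "\<lambda>n. {x :: 'a alg_closure. x ^ (q ^ n) = x}"
  let ?P = "\<lambda>n. {x \<in> ?V n. \<exists>m\<ge>1. (f ^^ m) x = x}"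
  let ?r = "\<lambda>n. real (periodic_count A n) / real (q ^ n)"
  have card: "card (UNIV :: 'a set) = p ^ k" using assms(3,4) by simp
  have charA: "CHAR('a) = p" by (rule CHAR_eq_prime[OF assms(1) card])
  then have char: "CHAR('a alg_closure) = p" by simp
  have char': "prime CHAR('a alg_closure)" "q = CHAR('a alg_closure) ^ k"
    using char assms(1,3) by simp_all
  have p1: "p > 1" using assms(1) by (rule prime_gt_1_nat)
  then have q1: "q > 1" unfolding assms(3) by (rule one_less_power) (use assms(2) in simp)
  have V: "card (?V n) = q ^ n" if "n \<ge> 1" for n
    using card_field_ext[OF assms(1) card that] field_ext_eq[OF assms(1) card that] assms(4)
    by simp
  have finV: "finite (?V n)" if "n \<ge> 1" for n
    using V[OF that] q1 by (intro card_ge_0_finite) simp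
  have pc: "periodic_count A n = card (?P n)" if "n \<ge> 1" for n
    unfolding periodic_count_def field_ext_eq[OF assms(1) card that] f_def assms(4) ..
  have add: "Modules.additive f" unfolding f_def by (rule additive_poly_imp_additive_map[OF assms(5)])
  have frob: "f (x ^ q) = f x ^ q" for x
    unfolding f_def assms(3) by (rule poly_to_ac_power_card[OF assms(1) card])
  have f0: "(f ^^ m) 0 = 0" for m by (rule additive.zero[OF additive_funpow[OF add]])
  have "\<not> convergent ?r" if nmon: "\<not> (\<exists>a h. A = Polynomial.monom a (p ^ h))"
  proof
    assume "convergent ?r"
    then obtain L where L: "?r \<longlonglongrightarrow> L" by (auto simp: convergent_def)
    obtain y where y: "y \<noteq> 0" "f y = 0"
      using additive_poly_nonzero_root[of A] assms(1,5) nmon unfolding charA f_def by blast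
    define S where "S = {x. f x = 0}"
    have "A \<noteq> 0" using nmon by (metis monom_eq_0)
    then have finS: "finite S"
      unfolding S_def f_def by (intro poly_roots_finite) (simp add: map_poly_eq_0_iff)
    \<comment> \<open>The Frobenius acts injectively on the finite set of roots, so every root is
      periodic under it.\<close>
    have "inj_on (\<lambda>x. x ^ q) S"
    proof (rule inj_onI)
      fix u v :: "'a alg_closure" assume "u ^ q = v ^ q"
      then have "(u - v) ^ q = 0" by (simp add: additive.diff[OF additive_Frobenius[OF char']])
      then show "u = v" by simp
    qed
    moreover have "(\<lambda>x. x ^ q) ` S \<subseteq> S" using q1 by (auto simp: S_def frob)
    ultimately obtain N where N: "N \<ge> 1" "\<forall>x\<in>S. ((\<lambda>x. x ^ q) ^^ N) x = x"
      using finite_common_period[OF finS, of "\<lambda>x. x ^ q"] periodic_if_inj_on_finite[OF finS] by metis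
    have roots: "x ^ (q ^ N) = x" if "f x = 0" for x
      using N(2) that by (simp add: S_def funpow_power)
    \<comment> \<open>These indices are 1 modulo both \<open>N\<close> and \<open>p\<close>, as the
      lower bound requires.\<close>
    have "1 / real q \<le> ?r (1 + N * (p * j))" for j
    proof -
      define n where "n = 1 + N * (p * j)"
      have "q ^ n \<le> card (?P n) * card {x :: 'a alg_closure. x ^ q = x}"
        using periodic_count_lower[OF char' add frob roots n_def[folded char] finV] V[of n]
        by (simp add: n_def)
      moreover have "card {x :: 'a alg_closure. x ^ q = x} = q" using V[of 1] by simp
      ultimately have "q ^ n \<le> card (?P n) * q" by (simp only:)
      then have "real (q ^ n) \<le> real (card (?P n) * q)" by (simp only: of_nat_le_iff)
      then have "1 / real q \<le> ?r n" using q1 pc[of n] by (simp add: n_def field_simps)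
      then show ?thesis unfolding n_def .
    qed
    moreover have "(\<lambda>j. ?r (1 + N * (p * j))) \<longlonglongrightarrow> L"
    proof -
      have "strict_mono (\<lambda>j. 1 + N * (p * j))" using N(1) p1 by (auto simp: strict_mono_def)
      from LIMSEQ_subseq_LIMSEQ[OF L this] show ?thesis by (simp add: o_def)
    qed
    ultimately have "1 / real q \<le> L" by (intro LIMSEQ_le_const) auto
    moreover have "L \<le> 0"
    proof -
      define c where "c = ?r N"
      \<comment> \<open>The root \<open>y\<close> lies in \<open>?V N\<close>, but its iterates from
        the first on are 0, so it is not periodic.\<close>
      have "card (?P N) < card (?V N)"
      proof (rule psubset_card_mono[OF finV[OF N(1)]])
        have "(f ^^ m) y \<noteq> y" if m: "m \<ge> 1" for m
        proof -
          obtain m' where "m = Suc m'" using m by (cases m) auto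
          then show ?thesis using y f0[of m'] by (simp add: funpow_Suc_right del: funpow.simps)
        qed
        then have "y \<notin> ?P N" by blast
        moreover have "y \<in> ?V N" using roots y by simp
        ultimately show "?P N \<subset> ?V N" by blast
      qed
      then have "real (card (?P N)) < real (q ^ N)" using V[OF N(1)] by (simp only: of_nat_less_iff)
      then have c: "0 \<le> c" "c < 1" using q1 pc[OF N(1)] by (simp_all add: c_def)
      \<comment> \<open>Since \<open>q ^ (N * p ^ e) = (q ^ N) ^ (p ^ e)\<close>, the bound on
        counts becomes the same bound on ratios.\<close>
      have "?r (N * p ^ e) \<le> c ^ (p ^ e)" for e
      proof -
        have n: "N * p ^ e \<ge> 1" using N(1) p1 by simp
        have "card (?P (N * p ^ e)) \<le> card (?P N) ^ (p ^ e)"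
          using periodic_count_upper[OF char' add frob finV[OF N(1)], of e] unfolding char .
        then have "real (card (?P (N * p ^ e))) \<le> real (card (?P N)) ^ (p ^ e)"
          unfolding of_nat_power[symmetric] of_nat_le_iff .
        then have "?r (N * p ^ e) \<le> real (periodic_count A N) ^ (p ^ e) / real (q ^ (N * p ^ e))"
          unfolding pc[OF n] pc[OF N(1)] by (rule divide_right_mono) simp
        also have "\<dots> = c ^ (p ^ e)" by (simp add: c_def power_divide power_mult)
        finally show ?thesis .
      qed
      moreover have "(\<lambda>e. ?r (N * p ^ e)) \<longlonglongrightarrow> L"
      proof -
        have "strict_mono (\<lambda>e. N * p ^ e)" using N(1) p1 by (auto simp: strict_mono_def)
        from LIMSEQ_subseq_LIMSEQ[OF L this] show ?thesis by (simp add: o_def)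
      qed
      moreover have "(\<lambda>e. c ^ (p ^ e)) \<longlonglongrightarrow> 0"
      proof -
        have "strict_mono (\<lambda>e. p ^ e)" using p1 by (auto simp: strict_mono_def)
        moreover have "(\<lambda>e. c ^ e) \<longlonglongrightarrow> 0" using c by (intro LIMSEQ_power_zero) simp
        ultimately show ?thesis using LIMSEQ_subseq_LIMSEQ[of "\<lambda>e. c ^ e"] by (simp add: o_def)
      qed
      ultimately show "L \<le> 0" by (intro LIMSEQ_le[of _ L]) auto
    qed
    moreover have "1 / real q > 0" using q1 by simp
    ultimately show False by linarith
  qed
  moreover have "?r \<longlonglongrightarrow> (if a = 0 then 0 else 1)" if A: "A = Polynomial.monom a (p ^ h)" for a h
  proof -
    have f: "f z = to_ac a * z ^ (p ^ h)" for z
      by (simp add: f_def A map_poly_monom poly_monom)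
    show ?thesis
    proof (cases "a = 0")
      case True
      have "?P n = {0}" for n
      proof -
        have "x = 0" if "(f ^^ m) x = x" "m \<ge> 1" for m x
        proof -
          have "(f ^^ m) x = 0" using that(2) by (cases m) (simp_all add: f True)
          then show ?thesis using that(1) by simp
        qed
        then show ?thesis using f0 q1 by (auto intro: exI[of _ 1])
      qed
      then have "?r n = 1 / real q ^ n" if "n \<ge> 1" for n using pc[OF that] by simp
      then have "eventually (\<lambda>n. 1 / real q ^ n = ?r n) sequentially"
        unfolding eventually_sequentially by metis
      moreover have "(\<lambda>n. 1 / real q ^ n) \<longlonglongrightarrow> 0"
        by (rule LIMSEQ_divide_realpow_zero) (use q1 in simp)
      ultimately have "?r \<longlonglongrightarrow> 0" by (rule Lim_transform_eventually[rotated])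
      then show ?thesis using True by simp
    next
      case False
      \<comment> \<open>A nonzero monomial has 0 as its only root, so \<open>f\<close> permutes each
        finite field.\<close>
      have "?P n = ?V n" if n: "n \<ge> 1" for n
      proof -
        have "inj_on f (?V n)"
        proof (rule inj_onI)
          fix u v assume "f u = f v"
          then have "f (u - v) = 0" by (simp add: additive.diff[OF add])
          then show "u = v" using False by (simp add: f)
        qed
        moreover have "f ` ?V n \<subseteq> ?V n"
        proof (rule image_subsetI)
          fix x assume "x \<in> ?V n"
          then show "f x \<in> ?V n" using commute_power_power[of f q x n, OF frob] by simp
        qed
        ultimately show ?thesis using periodic_if_inj_on_finite[OF finV[OF n]] by blast
      qed
      then have "?r n = 1" if "n \<ge> 1" for n using pc[OF that] V[OF that] that q1 by simp
      then have "eventually (\<lambda>n. 1 = ?r n) sequentially"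
        unfolding eventually_sequentially by metis
      then have "?r \<longlonglongrightarrow> 1" by (rule Lim_transform_eventually[OF tendsto_const])
      then show ?thesis using False by simp
    qed
  qed
  ultimately show ?thesis by blast
qed

end
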